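(* Let $g,d,c>0$ and $P_{\mathrm{atm}}\in\mathbb{R}$, and let $(\eta,u,v,P)$ be a smooth irrotational solitary gravity water wave with no underlying current, in the frame moving with the wave, as defined in the context, with fluid domain $\Omega=\{(x,y)\in\mathbb{R}^2 : -d<y<\eta(x),\ x\in\mathbb{R}\}$ and crest $(0,\eta(0))$. Define the dynamic pressure on $\overline{\Omega}$ by $$p(x,y)=P(x,y)-(P_{\mathrm{atm}}-gy).$$ Then: (i) $p$ attains its maximum over $\overline{\Omega}$ at the crest, i.e. $p(x,y)\le p(0,\eta(0))$ for all $(x,y)\in\overline{\Omega}$; (ii) $p(x,y)>0$ for all $(x,y)\in\Omega$; (iii) $p(x,y)\to 0$ as $|x|\to\infty$ with $(x,y)\in\overline{\Omega}$.
   Context: Water of constant density $1$ occupies a region above a flat bed $y=-d$ and below a free surface $y=\eta(x)$; coordinates $(x,y)$ move with the wave at its speed $c>0$, with $y$ pointing upwards and the undisturbed water level at $y=0$. $g>0$ is the gravitational acceleration and $P_{\mathrm{atm}}$ the constant atmospheric pressure. A smooth irrotational solitary wave (without underlying current) consists of a function $\eta:\mathbb{R}\to(-d,\infty)$ and functions $u,v,P:\overline{\Omega}\to\mathbb{R}$, where $\Omega=\{(x,y): -d<y<\eta(x)\}$, with $\eta$ smooth and $u,v,P$ smooth up to the boundary of $\Omega$, satisfying: (1) $u_x+v_y=0$ (incompressibility) and $u_y-v_x=0$ (irrotationality) in $\Omega$; (2) the steady Euler equations, for $-d\le y\le\eta(x)$: $(u-c)u_x+vu_y=-P_x$ and $(u-c)v_x+vv_y=-P_y-g$;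 (3) boundary conditions: $P=P_{\mathrm{atm}}$ and $v=(u-c)\eta_x$ on $y=\eta(x)$, and $v=0$ on $y=-d$; (4) asymptotic conditions (flat surface, fluid at rest, no underlying current): $\eta(x)\to0$, $u(x,y)\to0$ and $v(x,y)\to0$ as $|x|\to\infty$, the convergence of the velocity field being exponential: there are constants $K,\kappa>0$ with $|u(x,y)|+|v(x,y)|\le Ke^{-\kappa|x|}$ for all $(x,y)\in\overline{\Omega}$; (5) the wave is nontrivial, and the following known properties of solitary waves are part of the setting: $c>\sqrt{gd}$; $\eta$ is even and strictly decreasing on $[0,\infty)$, so that the unique crest is $(0,\eta(0))$; $u$ is even and $v$ is odd in $x$; $u<c$ throughout $\overline{\Omega}$ (the latter holds for every smooth wave, i.e. every wave other than the wave of greatest height). *)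

theory Defs
  imports "HOL-Analysis.Analysis"
begin

text \<open>
  Derivatives at boundary points of a set are Frechet derivatives within the set. They are
  meaningful where these are unique, as on the closed fluid region used below: its upper and lower
  boundaries are graphs of differentiable functions, so at each of its points the directions
  pointing into the region span the plane. At interior points they are the ordinary derivatives.
\<close>

definition dderiv_within ::
  "'a set \<Rightarrow> 'a \<Rightarrow> ('a \<Rightarrow> 'b) \<Rightarrow> 'a::real_normed_vector \<Rightarrow> 'b::real_normed_vector"
  where "dderiv_within S h f z = frechet_derivative f (at z within S) h"

text \<open>
  All iterated directional derivatives exist on the whole of the set and are themselves
  differentiable (hence continuous) there. For the closed fluid region this is smoothness up to the
  boundary; for \<^term>\<open>UNIV\<close> it is ordinary smoothness.
\<close>

definition smooth_on_set :: "'a::real_normed_vector set \<Rightarrow> ('a \<Rightarrow> 'b::real_normed_vector) \<Rightarrow> bool"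
  where "smooth_on_set S f \<longleftrightarrow> (\<forall>hs. foldr (dderiv_within S) hs f differentiable_on S)"

definition fluid_domain :: "real \<Rightarrow> (real \<Rightarrow> real) \<Rightarrow> (real \<times> real) set"
  where "fluid_domain d \<eta> = {(x, y). - d < y \<and> y < \<eta> x}"

text \<open>The filter for \<open>|x| \<rightarrow> \<infinity>\<close> with \<open>(x, y)\<close> in the closed fluid region.\<close>

definition far_field :: "real \<Rightarrow> (real \<Rightarrow> real) \<Rightarrow> (real \<times> real) filter"
  where "far_field d \<eta> = inf (filtercomap fst at_infinity) (principal (closure (fluid_domain d \<eta>)))"

locale fluid_region =
  fixes d :: real and \<eta> :: "real \<Rightarrow> real"
begin

abbreviation (input) \<Omega> :: "(real \<times> real) set" where "\<Omega> \<equiv> fluid_domain d \<eta>"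

abbreviation (input) Dx :: "(real \<times> real \<Rightarrow> real) \<Rightarrow> real \<times> real \<Rightarrow> real"
  where "Dx f \<equiv> dderiv_within (closure \<Omega>) (1, 0) f"

abbreviation (input) Dy :: "(real \<times> real \<Rightarrow> real) \<Rightarrow> real \<times> real \<Rightarrow> real"
  where "Dy f \<equiv> dderiv_within (closure \<Omega>) (0, 1) f"

end

text \<open>
  \<open>u\<close>, \<open>v\<close>, \<open>P\<close> are total functions, but only their values on the closed fluid region
  are constrained (and used).
\<close>

locale solitary_wave = fluid_region d \<eta>
  for g d c Patm :: real and \<eta> :: "real \<Rightarrow> real" +
  fixes u v P :: "real \<times> real \<Rightarrow> real"
  assumes surface_above_bed: "\<And>x. - d < \<eta> x"
    and smooth_surface: "smooth_on_set UNIV \<eta>"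
    and smooth_u: "smooth_on_set (closure \<Omega>) u"
    and smooth_v: "smooth_on_set (closure \<Omega>) v"
    and smooth_P: "smooth_on_set (closure \<Omega>) P"
    and incompressible: "\<And>z. z \<in> \<Omega> \<Longrightarrow> Dx u z + Dy v z = 0"
    and irrotational: "\<And>z. z \<in> \<Omega> \<Longrightarrow> Dy u z - Dx v z = 0"
    and euler_x: "\<And>x y. - d \<le> y \<Longrightarrow> y \<le> \<eta> x \<Longrightarrow>
      (u (x, y) - c) * Dx u (x, y) + v (x, y) * Dy u (x, y) = - Dx P (x, y)"
    and euler_y: "\<And>x y. - d \<le> y \<Longrightarrow> y \<le> \<eta> x \<Longrightarrow>
      (u (x, y) - c) * Dx v (x, y) + v (x, y) * Dy v (x, y) = - Dy P (x, y) - g"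
    and dynamic_bc: "\<And>x. P (x, \<eta> x) = Patm"
    and kinematic_surface_bc: "\<And>x. v (x, \<eta> x) = (u (x, \<eta> x) - c) * deriv \<eta> x"
    and kinematic_bed_bc: "\<And>x. v (x, - d) = 0"
    and surface_flat_at_infinity: "(\<eta> \<longlongrightarrow> 0) at_infinity"
    and u_at_infinity: "(u \<longlongrightarrow> 0) (far_field d \<eta>)"
    and v_at_infinity: "(v \<longlongrightarrow> 0) (far_field d \<eta>)"
    and exponential_decay: "\<exists>K>0. \<exists>\<kappa>>0. \<forall>(x, y)\<in>closure \<Omega>.
      \<bar>u (x, y)\<bar> + \<bar>v (x, y)\<bar> \<le> K * exp (- \<kappa> * \<bar>x\<bar>)"
    and nontrivial: "\<exists>x. \<eta> x \<noteq> 0"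
    and supercritical: "c > sqrt (g * d)"
    and surface_even: "\<And>x. \<eta> (- x) = \<eta> x"
    and surface_decreasing: "strict_antimono_on {0..} \<eta>"
    and u_even: "\<And>x y. (x, y) \<in> closure \<Omega> \<Longrightarrow> u (- x, y) = u (x, y)"
    and v_odd: "\<And>x y. (x, y) \<in> closure \<Omega> \<Longrightarrow> v (- x, y) = - v (x, y)"
    and no_stagnation: "\<And>z. z \<in> closure \<Omega> \<Longrightarrow> u z < c"

definition dynamic_pressure :: "real \<Rightarrow> real \<Rightarrow> (real \<times> real \<Rightarrow> real) \<Rightarrow> real \<times> real \<Rightarrow> real"
  where "dynamic_pressure g Patm P = (\<lambda>(x, y). P (x, y) - (Patm - g * y))"

end

theory Submission
  imports Defs "HOL-Complex_Analysis.Conformal_Mappings"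
begin

text \<open>
  In the frame of the wave the flow is steady and irrotational, so Bernoulli's law holds throughout
  the fluid, not only along streamlines: \<open>P + ((u - c)\<^sup>2 + v\<^sup>2) / 2 + g y\<close> is constant. The constant
  is read off on the surface far from the crest, and the law becomes
  \<open>2 p = c\<^sup>2 - ((u - c)\<^sup>2 + v\<^sup>2)\<close> (\<open>dynamic_pressure_eq\<close>). All three claims are thus claims about the relative speed
  \<open>sqrt ((u - c)\<^sup>2 + v\<^sup>2)\<close>: it tends to \<open>c\<close> in the far field, it is smaller than \<open>c\<close> inside the
  fluid, and it is smallest at the crest.

  The relative speed is the modulus of \<open>f = (u - c) - i v\<close>, which is holomorphic because the
  Cauchy--Riemann equations for \<open>f\<close> are incompressibility and irrotationality. On the bed
  \<open>f\<close> is real, so Schwarz reflection extends it to the region bounded by the surface and its mirror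
  image in the bed (\<open>reflected_velocity_holomorphic\<close>); this removes the bed from the boundary. On the remaining boundary the
  pressure is atmospheric and \<open>|f|\<^sup>2 = c\<^sup>2 - 2 g \<eta>\<close> lies in the interval
  \<open>[c\<^sup>2 - 2 g \<eta>(0), c\<^sup>2)\<close>, while \<open>f \<longlongrightarrow> -c\<close> at infinity. The maximum modulus principle for
  \<open>f\<close> gives \<open>|f| < c\<close> inside (\<open>speed_less\<close>), that is \<open>p > 0\<close>. Since \<open>u < c\<close>, the function \<open>f\<close> has no zeros, and
  the same principle for \<open>1 / f\<close> gives \<open>|f|\<^sup>2 \<ge> c\<^sup>2 - 2 g \<eta>(0)\<close> (\<open>speed_ge_at_crest\<close>), that is
  \<open>p \<le> g \<eta>(0)\<close>, the value of \<open>p\<close> at the crest.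
\<close>

section \<open>The maximum modulus principle with a limit at infinity\<close>

text \<open>
  The limit plays the role of the boundary value at the point at infinity: up to an error \<open>e\<close>,
  large circles may be added to the frontier of the set.
\<close>

lemma maximum_modulus_limit_at_infinity:
  fixes f :: "complex \<Rightarrow> complex"
  assumes S: "open S" and hol: "f holomorphic_on S" and cont: "continuous_on (closure S) f"
    and lim: "(f \<longlongrightarrow> L) (inf at_infinity (principal S))" and L: "norm L \<le> B"
    and fr: "\<And>z. z \<in> frontier S \<Longrightarrow> norm (f z) \<le> B"
    and z: "z \<in> S"
  shows "norm (f z) \<le> B"
proof (rule field_le_epsilon)
  fix e :: real assume e: "0 < e"
  have "eventually (\<lambda>w. dist (f w) L < e) (inf at_infinity (principal S))"
    using lim e by (rule tendstoD)
  then obtain R where R: "\<And>w. w \<in> S \<Longrightarrow> R \<le> norm w \<Longrightarrow> dist (f w) L < e"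
    by (auto simp: eventually_inf_principal eventually_at_infinity)
  have far: "norm (f w) \<le> B + e" if "w \<in> S" "R \<le> norm w" for w
    using R[OF that] L norm_triangle_ineq2[of "f w" L] by (simp add: dist_norm)
  define r where "r = max R (norm z + 1)"
  let ?U = "S \<inter> ball 0 r"
  show "norm (f z) \<le> B + e"
  proof (rule maximum_modulus_frontier[of f ?U])
    show "f holomorphic_on interior ?U"
      using hol by (rule holomorphic_on_subset) (use interior_subset in auto)
    show "continuous_on (closure ?U) f"
      using cont by (rule continuous_on_subset) (simp add: closure_mono)
    show "bounded ?U" by (simp add: bounded_Int)
    show "z \<in> ?U" using z by (simp add: r_def)
    fix w assume w: "w \<in> frontier ?U"
    have "open ?U" using S by auto
    then have notU: "w \<notin> ?U"
      using w interior_open[of ?U] unfolding frontier_def by blast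
    have clS: "w \<in> closure S"
      using w closure_mono[of ?U S] by (auto simp: frontier_def)
    show "norm (f w) \<le> B + e"
    proof (cases "w \<in> S")
      case True
      then have "R \<le> norm w" using notU by (auto simp: r_def)
      with True show ?thesis by (rule far)
    next
      case False
      then have "w \<in> frontier S" using clS S by (simp add: frontier_def interior_open)
      then show ?thesis using fr e by fastforce
    qed
  qed
qed

text \<open>
  If the bound were attained inside, \<open>f\<close> would be constant, and by continuity the bound would also
  be attained on the frontier. At infinity equality \<open>|L| = B\<close> is harmless, because infinity is
  only used for the weak bound.
\<close>

lemma strict_maximum_modulus_limit_at_infinity:
  fixes f :: "complex \<Rightarrow> complex"
  assumes S: "open S" "connected S" "S \<noteq> UNIV"
    and hol: "f holomorphic_on S" and cont: "continuous_on (closure S) f"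
    and lim: "(f \<longlongrightarrow> L) (inf at_infinity (principal S))" and L: "norm L \<le> B"
    and fr: "\<And>z. z \<in> frontier S \<Longrightarrow> norm (f z) < B"
    and z: "z \<in> S"
  shows "norm (f z) < B"
proof (rule ccontr)
  assume "\<not> norm (f z) < B"
  moreover have le: "norm (f w) \<le> B" if "w \<in> S" for w
    using maximum_modulus_limit_at_infinity[OF S(1) hol cont lim L _ that] fr less_imp_le
    by blast
  ultimately have eq: "norm (f z) = B" using z by fastforce
  have "f constant_on S"
    using maximum_modulus_principle[OF hol S(1,2,1) order_refl z] le eq by simp
  then have const: "f w = f z" if "w \<in> S" for w
    using that z unfolding constant_on_def by metis
  obtain w where w: "w \<in> frontier S"
    using frontier_not_empty[of S] S(3) z by auto
  then have "f w = f z"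
    using continuous_constant_on_closure[OF cont const] by (simp add: frontier_def)
  then show False using fr[OF w] eq by simp
qed

section \<open>Regions between two graphs\<close>

lemma open_between_graphs:
  fixes a b :: "real \<Rightarrow> real"
  assumes "continuous_on UNIV a" "continuous_on UNIV b"
  shows "open {(x, y). a x < y \<and> y < b x}"
  unfolding case_prod_beta
  by (intro open_Collect_conj open_Collect_less continuous_intros
      continuous_on_compose2[OF assms(1)] continuous_on_compose2[OF assms(2)]) auto

lemma connected_between_graphs:
  fixes a b :: "real \<Rightarrow> real"
  assumes ab: "\<And>x. a x < b x" and "continuous_on UNIV a" "continuous_on UNIV b"
  shows "connected {(x, y). a x < y \<and> y < b x}"
proof -
  let ?h = "\<lambda>z. (fst z, a (fst z) + snd z * (b (fst z) - a (fst z)))"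
  have "{(x, y). a x < y \<and> y < b x} = ?h ` (UNIV \<times> {0<..<1})"
  proof (intro equalityI subsetI)
    fix z assume "z \<in> {(x, y). a x < y \<and> y < b x}"
    then obtain x y where z: "z = (x, y)" "a x < y" "y < b x" by auto
    then have "z = ?h (x, (y - a x) / (b x - a x))"
      "(x, (y - a x) / (b x - a x)) \<in> UNIV \<times> {0<..<1}"
      by auto
    then show "z \<in> ?h ` (UNIV \<times> {0<..<1})" by (rule image_eqI)
  next
    fix z assume "z \<in> ?h ` (UNIV \<times> {0<..<1})"
    then obtain q where q: "z = ?h q" "q \<in> UNIV \<times> {0<..<1}" by (rule imageE)
    obtain x t where "q = (x, t)" by (cases q)
    with q have t: "z = (x, a x + t * (b x - a x))" "0 < t" "t < 1" by simp_all
    have "0 < t * (b x - a x)" "t * (b x - a x) < 1 * (b x - a x)"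
      using t ab[of x] by (auto intro: mult_strict_right_mono)
    then show "z \<in> {(x, y). a x < y \<and> y < b x}" using t by auto
  qed
  moreover have "connected (?h ` (UNIV \<times> {0<..<1}))"
    by (intro connected_continuous_image connected_Times continuous_intros
        continuous_on_compose2[OF assms(2)] continuous_on_compose2[OF assms(3)]) auto
  ultimately show ?thesis by simp
qed

lemma closed_between_graphs:
  fixes a b :: "real \<Rightarrow> real"
  assumes "continuous_on UNIV a" "continuous_on UNIV b"
  shows "closed {(x, y). a x \<le> y \<and> y \<le> b x}"
  unfolding case_prod_beta
  by (intro closed_Collect_conj closed_Collect_le continuous_intros
      continuous_on_compose2[OF assms(1)] continuous_on_compose2[OF assms(2)]) auto

lemma closure_between_graphs:
  fixes a b :: "real \<Rightarrow> real"
  assumes ab: "\<And>x. a x < b x" and "continuous_on UNIV a" "continuous_on UNIV b"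
  shows "closure {(x, y). a x < y \<and> y < b x} = {(x, y). a x \<le> y \<and> y \<le> b x}"
    (is "closure ?A = ?B")
proof
  show "closure ?A \<subseteq> ?B"
    by (rule closure_minimal[OF _ closed_between_graphs[OF assms(2,3)]]) auto
  show "?B \<subseteq> closure ?A"
  proof clarify
    fix x y assume "a x \<le> y" "y \<le> b x"
    then have "y \<in> closure {a x<..<b x}" using ab[of x] by simp
    moreover have "Pair x ` closure {a x<..<b x} \<subseteq> closure ?A"
      by (rule image_closure_subset)
        (auto intro!: continuous_intros intro: subsetD[OF closure_subset])
    ultimately show "(x, y) \<in> closure ?A" by blast
  qed
qed

section \<open>The closed fluid region\<close>

lemma smooth_on_set_imp_differentiable_on: "smooth_on_set S f \<Longrightarrow> f differentiable_on S"
  unfolding smooth_on_set_def by (drule spec[of _ "[]"]) simp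

context solitary_wave
begin

lemma continuous_surface: "continuous_on A \<eta>"
  using smooth_on_set_imp_differentiable_on[OF smooth_surface] differentiable_imp_continuous_on
    continuous_on_subset by blast

lemma continuous_fields:
  "continuous_on (closure \<Omega>) u" "continuous_on (closure \<Omega>) v" "continuous_on (closure \<Omega>) P"
  using smooth_u smooth_v smooth_P
  by (auto intro: differentiable_imp_continuous_on smooth_on_set_imp_differentiable_on)

lemma open_fluid_domain: "open \<Omega>"
  unfolding fluid_domain_def
  by (rule open_between_graphs) (auto intro: continuous_surface)

lemma connected_fluid_domain: "connected \<Omega>"
  unfolding fluid_domain_def
  by (rule connected_between_graphs) (auto intro: continuous_surface surface_above_bed)

lemma closure_fluid_domain: "closure \<Omega> = {(x, y). - d \<le> y \<and> y \<le> \<eta> x}"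
  unfolding fluid_domain_def
  by (rule closure_between_graphs) (auto intro: continuous_surface surface_above_bed)

lemma surface_le_crest: "\<eta> x \<le> \<eta> 0"
proof -
  have "\<eta> \<bar>x\<bar> \<le> \<eta> 0"
    using monotone_onD[OF surface_decreasing, of 0 "\<bar>x\<bar>"] by (cases "x = 0") auto
  then show ?thesis using surface_even[of x] by (cases "x \<ge> 0") auto
qed

text \<open>The elevation decreases strictly away from the crest towards its limit \<open>0\<close>.\<close>

lemma surface_positive: "0 < \<eta> x"
proof -
  have dec: "\<eta> s < \<eta> r" if "0 \<le> r" "r < s" for r s
    using surface_decreasing that unfolding monotone_on_def by auto
  have "(\<eta> \<longlongrightarrow> 0) at_top"
    using surface_flat_at_infinity at_top_le_at_infinity tendsto_mono by blast
  moreover have "eventually (\<lambda>s. \<eta> s \<le> \<eta> (\<bar>x\<bar> + 1)) at_top"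
    using eventually_gt_at_top[of "\<bar>x\<bar> + 1"] 
    by eventually_elim (rule less_imp_le[OF dec], auto)
  ultimately have "0 \<le> \<eta> (\<bar>x\<bar> + 1)"
    by (intro tendsto_upperbound) auto
  also have "\<dots> < \<eta> \<bar>x\<bar>" by (rule dec) auto
  also have "\<dots> = \<eta> x" using surface_even[of x] by (cases "x \<ge> 0") auto
  finally show ?thesis .
qed

lemma has_derivative_in_fluid:
  assumes f: "smooth_on_set (closure \<Omega>) f" and z: "z \<in> \<Omega>"
  shows "(f has_derivative (\<lambda>h. fst h * Dx f z + snd h * Dy f z)) (at z)"
proof -
  have at: "at z within closure \<Omega> = at z"
    using z open_fluid_domain closure_subset[of \<Omega>]
    by (meson at_within_interior interior_maximal subsetD)
  have "f differentiable (at z within closure \<Omega>)"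
    using smooth_on_set_imp_differentiable_on[OF f] z closure_subset
    unfolding differentiable_on_def by blast
  then have D: "(f has_derivative frechet_derivative f (at z)) (at z)"
    unfolding at by (simp add: frechet_derivative_works)
  have "frechet_derivative f (at z) h = fst h * Dx f z + snd h * Dy f z" for h
  proof -
    interpret linear "frechet_derivative f (at z)"
      using D by (rule has_derivative_linear)
    have h: "h = fst h *\<^sub>R (1, 0) + snd h *\<^sub>R (0, 1)" by (simp add: prod_eq_iff)
    show ?thesis
      by (subst h, subst add, subst scale, subst scale) (simp add: dderiv_within_def at)
  qed
  then show ?thesis using D by presburger
qed

section \<open>Bernoulli's law\<close>

text \<open>
  The gradient of the total head vanishes: irrotationality turns the convective terms of the Euler
  equations into the gradient of half the squared relative speed.
\<close>

lemma Bernoulli_constant: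
  assumes "z \<in> closure \<Omega>" "w \<in> closure \<Omega>"
  defines "H \<equiv> \<lambda>z. P z + ((u z - c)\<^sup>2 + (v z)\<^sup>2) / 2 + g * snd z"
  shows "H z = H w"
proof -
  have deriv: "(H has_derivative (\<lambda>h. 0)) (at z)" if z: "z \<in> \<Omega>" for z
  proof -
    obtain x y where xy: "z = (x, y)" "- d \<le> y" "y \<le> \<eta> x"
      using z by (cases z) (auto simp: fluid_domain_def)
    note D = has_derivative_in_fluid[OF smooth_u z] has_derivative_in_fluid[OF smooth_v z]
      has_derivative_in_fluid[OF smooth_P z] has_derivative_snd[OF has_derivative_ident]
    have Px: "Dx P z = - ((u z - c) * Dx u z + v z * Dy u z)"
      and Py: "Dy P z = - ((u z - c) * Dx v z + v z * Dy v z) - g"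
      using euler_x[OF xy(2,3)] euler_y[OF xy(2,3)] by (auto simp: xy(1))
    have rot: "Dy u z = Dx v z" using irrotational[OF z] by simp
    have "(H has_derivative (\<lambda>h. (fst h * Dx P z + snd h * Dy P z)
        + (u z - c) * (fst h * Dx u z + snd h * Dy u z)
        + v z * (fst h * Dx v z + snd h * Dy v z) + g * snd h)) (at z)"
      unfolding H_def by (auto intro!: derivative_eq_intros D simp: fun_eq_iff field_simps)
    moreover have "(fst h * Dx P z + snd h * Dy P z)
        + (u z - c) * (fst h * Dx u z + snd h * Dy u z)
        + v z * (fst h * Dx v z + snd h * Dy v z) + g * snd h = 0" for h
      by (simp add: Px Py rot algebra_simps)
    ultimately show ?thesis by simp
  qed
  have const: "H z = H w" if "z \<in> \<Omega>" "w \<in> \<Omega>" for z w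
    using has_derivative_zero_unique_connected[OF open_fluid_domain connected_fluid_domain deriv] that
    by blast
  have cont: "continuous_on (closure \<Omega>) H"
    unfolding H_def by (intro continuous_intros continuous_fields) auto
  have half: "H z = H w" if "z \<in> closure \<Omega>" "w \<in> \<Omega>" for z w
    using continuous_constant_on_closure[OF cont const[OF _ that(2)] that(1)] .
  have "\<Omega> \<noteq> {}" using assms(1) by auto
  then show ?thesis using half[OF assms(1)] half[OF assms(2)] by fastforce
qed

lemma surface_far_field: "filterlim (\<lambda>x. (x, \<eta> x)) (far_field d \<eta>) at_infinity"
proof -
  have "filterlim (\<lambda>x. x) at_infinity (at_infinity :: real filter)" by (rule filterlim_ident)
  moreover have "(x, \<eta> x) \<in> closure \<Omega>" for x
    using surface_above_bed[of x] by (auto simp: closure_fluid_domain)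
  ultimately show ?thesis
    unfolding far_field_def
    by (simp add: filterlim_inf filterlim_filtercomap_iff o_def filterlim_principal)
qed

text \<open>
  The constant is the limit of the total head along the surface, where the pressure is known and
  the elevation and the velocity tend to zero.
\<close>

lemma dynamic_pressure_eq:
  assumes z: "z \<in> closure \<Omega>"
  shows "dynamic_pressure g Patm P z = (c\<^sup>2 - ((u z - c)\<^sup>2 + (v z)\<^sup>2)) / 2"
proof -
  let ?H = "P z + ((u z - c)\<^sup>2 + (v z)\<^sup>2) / 2 + g * snd z"
  have "((\<lambda>x. Patm + ((u (x, \<eta> x) - c)\<^sup>2 + (v (x, \<eta> x))\<^sup>2) / 2 + g * \<eta> x)
      \<longlongrightarrow> Patm + ((0 - c)\<^sup>2 + 0\<^sup>2) / 2 + g * 0) at_infinity"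
    by (intro tendsto_intros surface_flat_at_infinity
        filterlim_compose[OF u_at_infinity surface_far_field]
        filterlim_compose[OF v_at_infinity surface_far_field]) simp_all
  moreover have "Patm + ((u (x, \<eta> x) - c)\<^sup>2 + (v (x, \<eta> x))\<^sup>2) / 2 + g * \<eta> x = ?H" for x
  proof -
    have "(x, \<eta> x) \<in> closure \<Omega>"
      using surface_above_bed[of x] by (auto simp: closure_fluid_domain)
    from Bernoulli_constant[OF this z] show ?thesis by (simp add: dynamic_bc)
  qed
  ultimately have "((\<lambda>x::real. ?H) \<longlongrightarrow> Patm + c\<^sup>2 / 2) at_infinity" by simp
  moreover have "(at_infinity :: real filter) \<noteq> bot"
    using at_top_le_at_infinity trivial_limit_at_top_linorder by (metis bot.extremum_uniqueI)
  ultimately have "?H = Patm + c\<^sup>2 / 2" by (simp add: tendsto_const_iff)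
  then show ?thesis by (cases z) (simp add: dynamic_pressure_def field_simps)
qed

lemma dynamic_pressure_surface: "dynamic_pressure g Patm P (x, \<eta> x) = g * \<eta> x"
  by (simp add: dynamic_pressure_def dynamic_bc)

section \<open>The complex velocity and its reflection in the bed\<close>

text \<open>
  The height is measured from the bed, so that the bed becomes the real axis. The region consists
  of the fluid, the bed and the mirror image of the fluid.
\<close>

definition reflected_region :: "complex set"
  where "reflected_region = {z. \<bar>Im z\<bar> < \<eta> (Re z) + d}"

definition fold_to_fluid :: "complex \<Rightarrow> real \<times> real"
  where "fold_to_fluid z = (Re z, \<bar>Im z\<bar> - d)"

definition complex_velocity :: "complex \<Rightarrow> complex"
  where "complex_velocity z =
    of_real (u (Re z, Im z - d) - c) - \<i> * of_real (v (Re z, Im z - d))"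

definition reflected_velocity :: "complex \<Rightarrow> complex"
  where "reflected_velocity z =
    (if 0 \<le> Im z then complex_velocity z else cnj (complex_velocity (cnj z)))"

lemma reflected_region_eq_vimage:
  "reflected_region = (\<lambda>z. (Re z, Im z)) -` {(x, y). - (\<eta> x + d) < y \<and> y < \<eta> x + d}"
  by (auto simp: reflected_region_def abs_less_iff)

lemma open_reflected_region: "open reflected_region"
  unfolding reflected_region_eq_vimage
  by (intro open_vimage open_between_graphs) (auto intro!: continuous_intros continuous_surface)

lemma connected_reflected_region: "connected reflected_region"
proof -
  have eq: "reflected_region =
      (\<lambda>z. Complex (fst z) (snd z)) ` {(x, y). - (\<eta> x + d) < y \<and> y < \<eta> x + d}"
    (is "_ = ?f ` ?A")
  proof (intro equalityI subsetI)
    fix z assume "z \<in> reflected_region"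
    then have "z = ?f (Re z, Im z)" "(Re z, Im z) \<in> ?A"
      by (auto simp: reflected_region_eq_vimage)
    then show "z \<in> ?f ` ?A" by (rule image_eqI)
  qed (auto simp: reflected_region_eq_vimage)
  have "- (\<eta> x + d) < \<eta> x + d" for x using surface_above_bed[of x] by simp
  then show ?thesis
    unfolding eq Complex_eq
    by (intro connected_continuous_image connected_between_graphs)
      (auto intro!: continuous_intros continuous_surface)
qed

lemma closure_reflected_region: "closure reflected_region \<subseteq> {z. \<bar>Im z\<bar> \<le> \<eta> (Re z) + d}"
  by (rule closure_minimal)
    (auto simp: reflected_region_def
      intro!: closed_Collect_le continuous_intros continuous_on_compose2[OF continuous_surface])

lemma fold_in_closed_fluid: "z \<in> closure reflected_region \<Longrightarrow> fold_to_fluid z \<in> closure \<Omega>"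
  using closure_reflected_region by (force simp: fold_to_fluid_def closure_fluid_domain)

lemma fold_of_frontier:
  assumes "z \<in> frontier reflected_region"
  shows "fold_to_fluid z = (Re z, \<eta> (Re z))"
proof -
  have "z \<in> closure reflected_region" "z \<notin> reflected_region"
    using assms open_reflected_region by (auto simp: frontier_def interior_open)
  then show ?thesis
    using closure_reflected_region by (force simp: fold_to_fluid_def reflected_region_def)
qed

lemma reflected_region_not_UNIV: "reflected_region \<noteq> UNIV"
proof
  assume "reflected_region = UNIV"
  then have "Complex 0 (\<eta> 0 + d) \<in> reflected_region" by simp
  then show False by (simp add: reflected_region_def)
qed

lemma norm_reflected_velocity:
  "(norm (reflected_velocity z))\<^sup>2 = (u (fold_to_fluid z) - c)\<^sup>2 + (v (fold_to_fluid z))\<^sup>2"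
  by (simp add: reflected_velocity_def complex_velocity_def fold_to_fluid_def cmod_power2)

lemma reflected_velocity_nonzero:
  assumes "z \<in> closure reflected_region"
  shows "reflected_velocity z \<noteq> 0"
proof
  assume "reflected_velocity z = 0"
  then have "(u (fold_to_fluid z) - c)\<^sup>2 + (v (fold_to_fluid z))\<^sup>2 = 0"
    using norm_reflected_velocity[of z] by simp
  then have "u (fold_to_fluid z) = c" by (simp add: sum_power2_eq_zero_iff)
  then show False using no_stagnation[OF fold_in_closed_fluid[OF assms]] by simp
qed

text \<open>
  The Cauchy--Riemann equations for \<open>u - i v\<close> are \<open>u\<^sub>x = - v\<^sub>y\<close> and \<open>u\<^sub>y = v\<^sub>x\<close>: incompressibility and
  irrotationality.
\<close>

lemma complex_velocity_has_field_derivative: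
  assumes z: "(Re z, Im z - d) \<in> \<Omega>"
  shows "(complex_velocity has_field_derivative
    (of_real (Dx u (Re z, Im z - d)) - \<i> * of_real (Dx v (Re z, Im z - d)))) (at z)"
proof -
  let ?T = "\<lambda>z. (Re z, Im z - d)"
  have T: "(?T has_derivative (\<lambda>h. (Re h, Im h))) (at z)"
    by (auto intro!: derivative_eq_intros)
  have U: "((\<lambda>z. u (?T z)) has_derivative
      (\<lambda>h. Re h * Dx u (?T z) + Im h * Dy u (?T z))) (at z)"
    using has_derivative_compose[OF T has_derivative_in_fluid[OF smooth_u z]] by simp
  have V: "((\<lambda>z. v (?T z)) has_derivative
      (\<lambda>h. Re h * Dx v (?T z) + Im h * Dy v (?T z))) (at z)"
    using has_derivative_compose[OF T has_derivative_in_fluid[OF smooth_v z]] by simp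
  have CR: "Dy u (?T z) = Dx v (?T z)" "Dy v (?T z) = - Dx u (?T z)"
    using irrotational[OF z] incompressible[OF z] by auto
  show ?thesis
    unfolding has_field_derivative_def complex_velocity_def
    by (rule derivative_eq_intros U V refl)+ (auto simp: fun_eq_iff CR complex_eq_iff algebra_simps)
qed

lemma continuous_complex_velocity:
  assumes "\<And>z. z \<in> A \<Longrightarrow> (Re z, Im z - d) \<in> closure \<Omega>"
  shows "continuous_on A complex_velocity"
  unfolding complex_velocity_def
  by (intro continuous_intros continuous_on_compose2[OF continuous_fields(1)]
      continuous_on_compose2[OF continuous_fields(2)]) (use assms in auto)

lemma complex_velocity_bed_real: "Im z = 0 \<Longrightarrow> complex_velocity z \<in> \<real>"
  by (simp add: complex_velocity_def kinematic_bed_bc)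

lemma reflected_velocity_holomorphic: "reflected_velocity holomorphic_on reflected_region"
  unfolding reflected_velocity_def
proof (rule Schwarz_reflection)
  show "open reflected_region" by (rule open_reflected_region)
  show "cnj ` reflected_region \<subseteq> reflected_region" by (auto simp: reflected_region_def)
  show "complex_velocity holomorphic_on reflected_region \<inter> {z. 0 < Im z}"
  proof (rule holomorphic_onI)
    fix z assume "z \<in> reflected_region \<inter> {z. 0 < Im z}"
    then have "(Re z, Im z - d) \<in> \<Omega>" by (auto simp: reflected_region_def fluid_domain_def)
    then show "complex_velocity field_differentiable at z within reflected_region \<inter> {z. 0 < Im z}"
      using complex_velocity_has_field_derivative field_differentiable_at_within
        field_differentiable_def by blast
  qed
  show "continuous_on (reflected_region \<inter> {z. 0 \<le> Im z}) complex_velocity"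
    by (rule continuous_complex_velocity) (auto simp: reflected_region_def closure_fluid_domain)
  show "complex_velocity z \<in> \<real>" if "z \<in> \<real>" for z
    using that complex_velocity_bed_real complex_is_Real_iff by blast
qed

lemma continuous_reflected_velocity: "continuous_on (closure reflected_region) reflected_velocity"
proof -
  let ?C = "closure reflected_region"
  have split: "?C = (?C \<inter> {z. 0 \<le> Im z}) \<union> (?C \<inter> {z. Im z \<le> 0})" by auto
  have "continuous_on ((?C \<inter> {z. 0 \<le> Im z}) \<union> (?C \<inter> {z. Im z \<le> 0}))
    (\<lambda>z. if 0 \<le> Im z then complex_velocity z else cnj (complex_velocity (cnj z)))"
  proof (rule continuous_on_cases)
    show "closed (?C \<inter> {z. 0 \<le> Im z})" "closed (?C \<inter> {z. Im z \<le> 0})"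
      by (auto intro: closed_halfspace_Im_ge closed_halfspace_Im_le)
    show "continuous_on (?C \<inter> {z. 0 \<le> Im z}) complex_velocity"
      by (rule continuous_complex_velocity)
        (use closure_reflected_region in \<open>force simp: closure_fluid_domain\<close>)
    have cont: "continuous_on (cnj ` (?C \<inter> {z. Im z \<le> 0})) complex_velocity"
      by (rule continuous_complex_velocity)
        (use closure_reflected_region in \<open>force simp: closure_fluid_domain\<close>)
    show "continuous_on (?C \<inter> {z. Im z \<le> 0}) (\<lambda>z. cnj (complex_velocity (cnj z)))"
      by (rule continuous_on_cnj[OF continuous_on_compose2[OF cont
              continuous_on_cnj[OF continuous_on_id]]]) simp
    show "\<forall>z. z \<in> ?C \<inter> {z. 0 \<le> Im z} \<and> \<not> 0 \<le> Im z \<or> z \<in> ?C \<inter> {z. Im z \<le> 0} \<and> 0 \<le> Im z \<longrightarrow>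
      complex_velocity z = cnj (complex_velocity (cnj z))"
    proof (intro allI impI)
      fix z assume "z \<in> ?C \<inter> {z. 0 \<le> Im z} \<and> \<not> 0 \<le> Im z \<or> z \<in> ?C \<inter> {z. Im z \<le> 0} \<and> 0 \<le> Im z"
      then have "Im z = 0" by auto
      then have "cnj z = z" "cnj (complex_velocity z) = complex_velocity z"
        using complex_velocity_bed_real[of z] by (auto simp: complex_eq_iff Reals_cnj_iff)
      then show "complex_velocity z = cnj (complex_velocity (cnj z))" by simp
    qed
  qed
  then show ?thesis unfolding reflected_velocity_def[abs_def] split[symmetric] .
qed

text \<open>
  The reflected region has bounded height because the crest is its highest point, so within it
  \<open>|z| \<rightarrow> \<infinity>\<close> forces \<open>|x| \<rightarrow> \<infinity>\<close>.
\<close>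

lemma fold_far_field:
  "filterlim fold_to_fluid (far_field d \<eta>) (inf at_infinity (principal reflected_region))"
proof -
  have "filterlim Re at_infinity (inf at_infinity (principal reflected_region))"
    unfolding filterlim_at_infinity[OF order_refl]
  proof (intro allI impI)
    fix r :: real
    have "r \<le> norm (Re z)" if "z \<in> reflected_region" "r + \<eta> 0 + d \<le> norm z" for z
      using that cmod_le[of z] surface_le_crest[of "Re z"] by (simp add: reflected_region_def)
    then show "eventually (\<lambda>z. r \<le> norm (Re z)) (inf at_infinity (principal reflected_region))"
      by (auto simp: eventually_inf_principal eventually_at_infinity intro!: exI[of _ "r + \<eta> 0 + d"])
  qed
  moreover have "fold_to_fluid z \<in> closure \<Omega>" if "z \<in> reflected_region" for z
    using that fold_in_closed_fluid closure_subset by blast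
  ultimately show ?thesis
    unfolding far_field_def
    by (simp add: filterlim_inf filterlim_filtercomap_iff o_def filterlim_principal
        eventually_inf_principal fold_to_fluid_def[abs_def])
qed

lemma reflected_velocity_limit:
  "(reflected_velocity \<longlongrightarrow> - of_real c) (inf at_infinity (principal reflected_region))"
proof -
  let ?F = "inf at_infinity (principal reflected_region)"
  have lim: "((\<lambda>z. \<bar>u (fold_to_fluid z)\<bar> + \<bar>v (fold_to_fluid z)\<bar>) \<longlongrightarrow> 0) ?F"
    by (intro tendsto_add_zero tendsto_rabs_zero filterlim_compose[OF u_at_infinity fold_far_field]
        filterlim_compose[OF v_at_infinity fold_far_field])
  have le: "norm (reflected_velocity z - - of_real c)
      \<le> \<bar>u (fold_to_fluid z)\<bar> + \<bar>v (fold_to_fluid z)\<bar>" for z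
    using cmod_le[of "reflected_velocity z - - of_real c"]
    by (simp add: reflected_velocity_def complex_velocity_def fold_to_fluid_def split: if_splits)
  have "((\<lambda>z. reflected_velocity z - - of_real c) \<longlongrightarrow> 0) ?F"
    by (rule Lim_null_comparison[OF always_eventually lim]) (use le in blast)
  then show ?thesis by (rule Lim_null[THEN iffD2])
qed

section \<open>Bounds on the relative speed and on the pressure\<close>

lemma speed_on_frontier:
  assumes "z \<in> frontier reflected_region"
  shows "(norm (reflected_velocity z))\<^sup>2 = c\<^sup>2 - 2 * g * \<eta> (Re z)"
proof -
  have "(Re z, \<eta> (Re z)) \<in> closure \<Omega>"
    using surface_above_bed[of "Re z"] by (auto simp: closure_fluid_domain)
  from dynamic_pressure_eq[OF this] show ?thesis
    by (simp add: dynamic_pressure_surface norm_reflected_velocity fold_of_frontier[OF assms])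
qed

text \<open>
  On the boundary the speed is below \<open>c\<close> because the surface lies above the undisturbed level;
  the value \<open>c\<close> is approached only at infinity.
\<close>

lemma speed_less:
  assumes "0 < g" "0 < c" and z: "z \<in> reflected_region"
  shows "norm (reflected_velocity z) < c"
proof (rule strict_maximum_modulus_limit_at_infinity[OF open_reflected_region
      connected_reflected_region reflected_region_not_UNIV reflected_velocity_holomorphic
      continuous_reflected_velocity reflected_velocity_limit _ _ z])
  show "norm (- complex_of_real c) \<le> c" using assms by simp
  fix w assume "w \<in> frontier reflected_region"
  then have "(norm (reflected_velocity w))\<^sup>2 < c\<^sup>2"
    using assms surface_positive[of "Re w"] by (simp add: speed_on_frontier)
  then show "norm (reflected_velocity w) < c" 
    by (rule power2_less_imp_less) (use assms in simp)
qed

text \<open>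
  The left-hand side is the squared speed at the crest. It is the least value on the boundary
  because the crest is the highest point of the surface, and it is positive because the crest is
  not a stagnation point; a minimum of \<open>|f|\<close> becomes a maximum of \<open>|1 / f|\<close>.
\<close>

lemma speed_ge_at_crest:
  assumes "0 < g" "0 < c" and z: "z \<in> reflected_region"
  shows "c\<^sup>2 - 2 * g * \<eta> 0 \<le> (norm (reflected_velocity z))\<^sup>2"
proof -
  define m where "m = sqrt (c\<^sup>2 - 2 * g * \<eta> 0)"
  have crest: "(0, \<eta> 0) \<in> closure \<Omega>"
    using surface_above_bed[of 0] by (auto simp: closure_fluid_domain)
  have "0 < (u (0, \<eta> 0) - c)\<^sup>2 + (v (0, \<eta> 0))\<^sup>2"
    using no_stagnation[OF crest] by (intro add_pos_nonneg) auto
  also have "\<dots> = c\<^sup>2 - 2 * g * \<eta> 0"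
    using dynamic_pressure_eq[OF crest] by (simp add: dynamic_pressure_surface)
  finally have m: "0 < m" "m\<^sup>2 = c\<^sup>2 - 2 * g * \<eta> 0" by (simp_all add: m_def)
  have nz: "reflected_velocity w \<noteq> 0" if "w \<in> reflected_region" for w
    using that reflected_velocity_nonzero closure_subset by blast
  have "norm (inverse (reflected_velocity z)) \<le> inverse m"
  proof (rule maximum_modulus_limit_at_infinity[OF open_reflected_region _ _ _ _ _ z])
    show "(\<lambda>w. inverse (reflected_velocity w)) holomorphic_on reflected_region"
      using nz by (intro holomorphic_intros reflected_velocity_holomorphic) auto
    show "continuous_on (closure reflected_region) (\<lambda>w. inverse (reflected_velocity w))"
      using reflected_velocity_nonzero by (intro continuous_intros continuous_reflected_velocity) auto
    show "((\<lambda>w. inverse (reflected_velocity w)) \<longlongrightarrow> inverse (- of_real c))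
        (inf at_infinity (principal reflected_region))"
      using assms by (intro tendsto_inverse reflected_velocity_limit) auto
    have "m\<^sup>2 \<le> c\<^sup>2" using assms surface_positive[of 0] m by simp
    then have "m \<le> c" using assms by (intro power2_le_imp_le[of m c]) auto
    then show "norm (inverse (- complex_of_real c)) \<le> inverse m"
      using m assms by (simp add: norm_inverse le_imp_inverse_le)
    fix w assume "w \<in> frontier reflected_region"
    then have "m\<^sup>2 \<le> (norm (reflected_velocity w))\<^sup>2"
      using assms m surface_le_crest[of "Re w"] by (simp add: speed_on_frontier)
    then have "m \<le> norm (reflected_velocity w)" by (rule power2_le_imp_le) simp
    then show "norm (inverse (reflected_velocity w)) \<le> inverse m"
      using m by (simp add: norm_inverse le_imp_inverse_le)
  qed
  then have "m \<le> norm (reflected_velocity z)"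
    using m nz[OF z] by (simp add: norm_inverse)
  then show ?thesis using m power_mono[of m "norm (reflected_velocity z)" 2] by simp
qed

lemma dynamic_pressure_eq_reflected:
  assumes "- d \<le> y" "y < \<eta> x"
  defines "z \<equiv> Complex x (y + d)"
  shows "z \<in> reflected_region"
    and "dynamic_pressure g Patm P (x, y) = (c\<^sup>2 - (norm (reflected_velocity z))\<^sup>2) / 2"
proof -
  show "z \<in> reflected_region" using assms by (simp add: reflected_region_def)
  have "(x, y) \<in> closure \<Omega>" using assms by (simp add: closure_fluid_domain)
  then show "dynamic_pressure g Patm P (x, y) = (c\<^sup>2 - (norm (reflected_velocity z))\<^sup>2) / 2"
    using assms by (simp add: dynamic_pressure_eq norm_reflected_velocity fold_to_fluid_def)
qed

lemma dynamic_pressure_le_crest: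
  assumes "0 < g" "0 < c" and "(x, y) \<in> closure \<Omega>"
  shows "dynamic_pressure g Patm P (x, y) \<le> dynamic_pressure g Patm P (0, \<eta> 0)"
proof (cases "y = \<eta> x")
  case True
  then show ?thesis using assms surface_le_crest[of x] by (simp add: dynamic_pressure_surface)
next
  case False
  then have "- d \<le> y" "y < \<eta> x" using assms by (auto simp: closure_fluid_domain)
  note refl = dynamic_pressure_eq_reflected[OF this]
  show ?thesis
    using speed_ge_at_crest[OF assms(1,2) refl(1)] by (simp add: refl(2) dynamic_pressure_surface)
qed

lemma dynamic_pressure_positive:
  assumes "0 < g" "0 < c" and "(x, y) \<in> \<Omega>"
  shows "0 < dynamic_pressure g Patm P (x, y)"
proof -
  have "- d \<le> y" "y < \<eta> x" using assms by (auto simp: fluid_domain_def)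
  note refl = dynamic_pressure_eq_reflected[OF this]
  show ?thesis
    using power_strict_mono[OF speed_less[OF assms(1,2) refl(1)], of 2] by (simp add: refl(2))
qed

lemma dynamic_pressure_far_field: "(dynamic_pressure g Patm P \<longlongrightarrow> 0) (far_field d \<eta>)"
proof (rule Lim_transform_eventually)
  have "((\<lambda>z. (c\<^sup>2 - ((u z - c)\<^sup>2 + (v z)\<^sup>2)) / 2) \<longlongrightarrow> (c\<^sup>2 - ((0 - c)\<^sup>2 + 0\<^sup>2)) / 2)
      (far_field d \<eta>)"
    by (intro tendsto_intros u_at_infinity v_at_infinity) simp
  then show "((\<lambda>z. (c\<^sup>2 - ((u z - c)\<^sup>2 + (v z)\<^sup>2)) / 2) \<longlongrightarrow> 0) (far_field d \<eta>)" by simp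
  show "\<forall>\<^sub>F z in far_field d \<eta>.
      (c\<^sup>2 - ((u z - c)\<^sup>2 + (v z)\<^sup>2)) / 2 = dynamic_pressure g Patm P z"
    by (simp add: far_field_def eventually_inf_principal dynamic_pressure_eq)
qed

end

theorem theorem1:
  fixes g d c Patm :: real
    and \<eta> :: "real \<Rightarrow> real"
    and u v P :: "real \<times> real \<Rightarrow> real"
  assumes "g > 0" and "d > 0" and "c > 0"
    and "solitary_wave g d c Patm \<eta> u v P"
  defines "p \<equiv> dynamic_pressure g Patm P"
  shows "(\<forall>(x, y)\<in>closure (fluid_domain d \<eta>). p (x, y) \<le> p (0, \<eta> 0))
    \<and> (\<forall>(x, y)\<in>fluid_domain d \<eta>. p (x, y) > 0)
    \<and> (p \<longlongrightarrow> 0) (far_field d \<eta>)"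
proof -
  interpret solitary_wave g d c Patm \<eta> u v P by fact
  show ?thesis
    unfolding p_def
    using dynamic_pressure_le_crest[OF assms(1,3)] dynamic_pressure_positive[OF assms(1,3)]
      dynamic_pressure_far_field
    by auto
qed

end
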